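(* Let $n\geq 2$ and let $G$ be an $n$-connected graph of girth at least $n$. Let $T$ be a set of $n-1$ edges of $G$ incident to a vertex $v$ of degree at least $2n-2$. Then the $n$-point splitting graph $G'_T$ is $n$-connected.
   Context: $n$-point splitting: let $G$ be a graph with a vertex $v$ of degree at least $2n-2$ and let $T=\{vv_1,\dots,vv_{n-1}\}$ be a set of $n-1$ edges incident to $v$. The graph $G'_T$ is obtained from $G$ by replacing $v$ by two new adjacent vertices $u$ and $w$, where $u$ is made adjacent to $v_1,\dots,v_{n-1}$ and $w$ is made adjacent to all vertices that were adjacent to $v$ via edges other than those in $T$. *)

theory Defs
  imports Main "HOL-Library.Extended_Nat"
begin

text \<open>
  Undirected multigraphs: an edge is an abstract object carrying its set of end vertices,
  of cardinality 2, or 1 for a loop.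
\<close>

record ('v, 'e) multigraph =
  verts :: "'v set"
  edges :: "'e set"
  ends :: "'e \<Rightarrow> 'v set"

definition finite_graph :: "('v, 'e) multigraph \<Rightarrow> bool" where
  "finite_graph G \<longleftrightarrow> finite (verts G) \<and> finite (edges G) \<and>
     (\<forall>e\<in>edges G. ends G e \<subseteq> verts G \<and> card (ends G e) \<in> {1, 2})"

definition incident_edges :: "('v, 'e) multigraph \<Rightarrow> 'v \<Rightarrow> 'e set" where
  "incident_edges G v = {e \<in> edges G. v \<in> ends G e}"

text \<open>A loop contributes 2 to the degree.\<close>

definition degree :: "('v, 'e) multigraph \<Rightarrow> 'v \<Rightarrow> nat" where
  "degree G v = card (incident_edges G v) + card {e \<in> edges G. ends G e = {v}}"

definition adjacent :: "('v, 'e) multigraph \<Rightarrow> 'v \<Rightarrow> 'v \<Rightarrow> bool" where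
  "adjacent G x y \<longleftrightarrow> (\<exists>e\<in>edges G. ends G e = {x, y})"

definition connected_graph :: "('v, 'e) multigraph \<Rightarrow> bool" where
  "connected_graph G \<longleftrightarrow> verts G \<noteq> {} \<and>
     (\<forall>x\<in>verts G. \<forall>y\<in>verts G. (adjacent G)\<^sup>*\<^sup>* x y)"

definition delete_verts :: "('v, 'e) multigraph \<Rightarrow> 'v set \<Rightarrow> ('v, 'e) multigraph" where
  "delete_verts G S =
     \<lparr>verts = verts G - S, edges = {e \<in> edges G. ends G e \<inter> S = {}}, ends = ends G\<rparr>"

definition n_connected :: "nat \<Rightarrow> ('v, 'e) multigraph \<Rightarrow> bool" where
  "n_connected n G \<longleftrightarrow> card (verts G) > n \<and>
     (\<forall>S \<subseteq> verts G. card S < n \<longrightarrow> connected_graph (delete_verts G S))"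

text \<open>
  A cycle is given by its cyclic sequence of vertices and its cyclic sequence of edges.
  A loop is a cycle of length 1; since the edges are distinct, a cycle of length 2 is a
  pair of parallel edges.
\<close>

definition is_cycle :: "('v, 'e) multigraph \<Rightarrow> 'v list \<Rightarrow> 'e list \<Rightarrow> bool" where
  "is_cycle G vs es \<longleftrightarrow> es \<noteq> [] \<and> length vs = length es \<and> distinct vs \<and> distinct es \<and>
     set vs \<subseteq> verts G \<and> set es \<subseteq> edges G \<and>
     (\<forall>i < length es. ends G (es ! i) = {vs ! i, vs ! ((i + 1) mod length es)})"

text \<open>The girth of an acyclic graph is \<open>\<infinity>\<close>, as the infimum of the empty set.\<close>

definition girth :: "('v, 'e) multigraph \<Rightarrow> enat" where
  "girth G = Inf {enat (length es) | vs es. is_cycle G vs es}"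

text \<open>
  In the splitting of \<open>G\<close> at \<open>v\<close>, the two vertices replacing \<open>v\<close> are \<open>New_u\<close> and \<open>New_w\<close>,
  the edge joining them is \<open>None\<close>, and \<open>Some e\<close> is the edge corresponding to the edge
  \<open>e\<close> of \<open>G\<close>: its end \<open>v\<close>, if any, becomes \<open>New_u\<close> if \<open>e \<in> T\<close> and \<open>New_w\<close> otherwise.
\<close>

datatype 'v split_vertex = Old 'v | New_u | New_w

definition split_end :: "'v \<Rightarrow> bool \<Rightarrow> 'v \<Rightarrow> 'v split_vertex" where
  "split_end v in_T x = (if x \<noteq> v then Old x else if in_T then New_u else New_w)"

definition point_splitting ::
    "('v, 'e) multigraph \<Rightarrow> 'v \<Rightarrow> 'e set \<Rightarrow> ('v split_vertex, 'e option) multigraph" where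
  "point_splitting G v T =
     \<lparr>verts = Old ` (verts G - {v}) \<union> {New_u, New_w},
      edges = insert None (Some ` edges G),
      ends = (\<lambda>e'. case e' of
          None \<Rightarrow> {New_u, New_w}
        | Some e \<Rightarrow> split_end v (e \<in> T) ` ends G e)\<rparr>"

lemma finite_graph_point_splitting:
  assumes "finite_graph G"
  shows "finite_graph (point_splitting G v T)"
proof -
  have inj: "inj (split_end v b)" for b
    by (auto simp: inj_def split_end_def split: if_splits)
  have card: "card (split_end v b ` A) = card A" for b A
    by (rule card_image, rule inj_on_subset[OF inj]) simp
  have "split_end v b x \<in> Old ` (verts G - {v}) \<union> {New_u, New_w}" if "x \<in> verts G" for b x
    using that by (auto simp: split_end_def)
  then have sub: "split_end v b ` ends G e \<subseteq> Old ` (verts G - {v}) \<union> {New_u, New_w}"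
    if "e \<in> edges G" for b e
    using assms that unfolding finite_graph_def by blast
  show ?thesis
    using assms sub by (simp add: finite_graph_def point_splitting_def card)
qed

lemma adjacent_point_splitting_new:
  "adjacent (point_splitting G v T) New_u New_w"
  "adjacent (point_splitting G v T) New_u (Old x) \<longleftrightarrow>
     x \<noteq> v \<and> (\<exists>e \<in> edges G \<inter> T. ends G e = {v, x})"
  "adjacent (point_splitting G v T) New_w (Old x) \<longleftrightarrow>
     x \<noteq> v \<and> (\<exists>e \<in> edges G - T. ends G e = {v, x})"
proof -
  have inj: "inj (split_end v b)" for b
    by (auto simp: inj_def split_end_def split: if_splits)
  have u: "split_end v b ` A = {New_u, Old x} \<longleftrightarrow> b \<and> x \<noteq> v \<and> A = {v, x}" for b A
  proof
    assume eq: "split_end v b ` A = {New_u, Old x}"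
    then have "New_u \<in> split_end v b ` A" "Old x \<in> split_end v b ` A" by auto
    then have bx: "b" "x \<noteq> v" by (auto simp: split_end_def split: if_splits)
    then have "split_end v b ` A = split_end v b ` {v, x}" using eq by (simp add: split_end_def)
    then show "b \<and> x \<noteq> v \<and> A = {v, x}" using bx inj_image_eq_iff[OF inj] by metis
  qed (auto simp: split_end_def)
  have w: "split_end v b ` A = {New_w, Old x} \<longleftrightarrow> \<not> b \<and> x \<noteq> v \<and> A = {v, x}" for b A
  proof
    assume eq: "split_end v b ` A = {New_w, Old x}"
    then have "New_w \<in> split_end v b ` A" "Old x \<in> split_end v b ` A" by auto
    then have bx: "\<not> b" "x \<noteq> v" by (auto simp: split_end_def split: if_splits)
    then have "split_end v b ` A = split_end v b ` {v, x}" using eq by (simp add: split_end_def)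
    then show "\<not> b \<and> x \<noteq> v \<and> A = {v, x}" using bx inj_image_eq_iff[OF inj] by metis
  qed (auto simp: split_end_def)
  show "adjacent (point_splitting G v T) New_u New_w"
    by (simp add: adjacent_def point_splitting_def)
  show "adjacent (point_splitting G v T) New_u (Old x) \<longleftrightarrow>
     x \<noteq> v \<and> (\<exists>e \<in> edges G \<inter> T. ends G e = {v, x})"
    by (auto simp: adjacent_def point_splitting_def u doubleton_eq_iff)
  show "adjacent (point_splitting G v T) New_w (Old x) \<longleftrightarrow>
     x \<noteq> v \<and> (\<exists>e \<in> edges G - T. ends G e = {v, x})"
    by (auto simp: adjacent_def point_splitting_def w doubleton_eq_iff)
qed

end

theory Submission
  imports Defs
begin

text \<open>
  Girth at least \<open>n\<close> is only needed to see that any \<open>n - 1\<close> edges at \<open>v\<close> lead to \<open>n - 1\<close> distinct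
  neighbours: there are no loops, and no parallel edges unless \<open>n = 2\<close>. Let \<open>S\<close> be a set of fewer
  than \<open>n\<close> vertices of the splitting. If \<open>S\<close> avoids both new vertices, then \<open>G - S\<close> is connected and
  arises from the split graph minus \<open>S\<close> by contracting the new edge, so the latter is connected.
  Otherwise the old vertices outside \<open>S\<close> induce a subgraph of \<open>G\<close> with fewer than \<open>n\<close> vertices
  deleted, which is connected; a new vertex outside \<open>S\<close> has at least \<open>n - 1\<close> old neighbours, of which
  at most \<open>n - 2\<close> lie in \<open>S\<close>.
\<close>

section \<open>Vertex deletion, adjacency and connectedness\<close>

lemma verts_delete_verts [simp]: "verts (delete_verts G S) = verts G - S"
  by (simp add: delete_verts_def)

lemma adjacent_delete_verts:
  "adjacent (delete_verts G S) x y \<longleftrightarrow> adjacent G x y \<and> x \<notin> S \<and> y \<notin> S"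
  by (auto simp: adjacent_def delete_verts_def)

lemma adjacent_sym: "adjacent G x y \<Longrightarrow> adjacent G y x"
  by (simp add: adjacent_def insert_commute)

lemma adjacent_rtranclp_sym: "(adjacent G)\<^sup>*\<^sup>* x y \<Longrightarrow> (adjacent G)\<^sup>*\<^sup>* y x"
  by (rule sympD[OF symp_rtranclp[OF sympI]]) (rule adjacent_sym)

lemma connected_graphI:
  assumes "r \<in> verts G" and "\<And>x. x \<in> verts G \<Longrightarrow> (adjacent G)\<^sup>*\<^sup>* r x"
  shows "connected_graph G"
  unfolding connected_graph_def
proof (intro conjI ballI)
  show "verts G \<noteq> {}" using assms(1) by blast
  fix x y assume "x \<in> verts G" "y \<in> verts G"
  then show "(adjacent G)\<^sup>*\<^sup>* x y"
    by (rule rtranclp_trans[OF adjacent_rtranclp_sym[OF assms(2)] assms(2)])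
qed

section \<open>Short cycles and the neighbours of a vertex\<close>

lemma girth_le_cycle: "is_cycle G vs es \<Longrightarrow> girth G \<le> enat (length es)"
  unfolding girth_def by (rule Inf_lower) blast

lemma girth_le_loop:
  assumes "e \<in> edges G" "ends G e = {x}" "x \<in> verts G"
  shows "girth G \<le> 1"
proof -
  have "is_cycle G [x] [e]"
    using assms by (simp add: is_cycle_def)
  from girth_le_cycle[OF this] show ?thesis by (simp add: one_enat_def)
qed

lemma girth_le_parallel:
  assumes "e \<in> edges G" "f \<in> edges G" "e \<noteq> f" "ends G e = {x, y}" "ends G f = {x, y}"
    and "x \<noteq> y" "x \<in> verts G" "y \<in> verts G"
  shows "girth G \<le> 2"
proof -
  have "is_cycle G [x, y] [e, f]"
    using assms by (auto simp: is_cycle_def less_Suc_eq numeral_2_eq_2 insert_commute)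
  from girth_le_cycle[OF this] show ?thesis by (simp add: numeral_eq_enat numeral_2_eq_2)
qed

lemma incident_edge_ends:
  assumes "finite_graph G" "girth G \<ge> 2" "e \<in> incident_edges G v"
  obtains x where "x \<noteq> v" "x \<in> verts G" "ends G e = {v, x}"
proof -
  have e: "e \<in> edges G" "v \<in> ends G e" "ends G e \<subseteq> verts G"
    and card: "card (ends G e) = 1 \<or> card (ends G e) = 2"
    using assms by (auto simp: incident_edges_def finite_graph_def)
  have "card (ends G e) \<noteq> 1"
  proof
    assume "card (ends G e) = 1"
    with e have "ends G e = {v}" by (auto simp: card_1_singleton_iff)
    with e girth_le_loop have "girth G \<le> 1" by fastforce
    with assms(2) have "(2 :: enat) \<le> 1" by (rule order_trans)
    then show False by (simp add: numeral_eq_enat one_enat_def)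
  qed
  with card obtain a b where "ends G e = {a, b}" "a \<noteq> b" by (auto simp: card_2_iff)
  with e that show thesis by (metis insertE insertI1 insert_commute insert_subset singletonD)
qed

text \<open>Sending each edge of \<open>F\<close> to its end other than \<open>v\<close> is
  injective, as two edges with the same image would be parallel. The resulting \<open>n - 1\<close>
  neighbours cannot all lie in the smaller set \<open>A\<close>. It serves both new vertices: once
  with the edges in \<open>T\<close>, once with edges outside \<open>T\<close>.\<close>

lemma incident_edge_avoiding:
  assumes "n \<ge> 2" "finite_graph G" "girth G \<ge> enat n" "v \<in> verts G"
    and F: "F \<subseteq> incident_edges G v" "card F = n - 1"
    and A: "finite A" "card A < n - 1"
  obtains e x where "e \<in> F" "x \<noteq> v" "x \<in> verts G" "x \<notin> A" "ends G e = {v, x}"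
proof -
  have "(2 :: enat) \<le> enat n" using assms(1) by (simp add: numeral_eq_enat)
  then have girth2: "girth G \<ge> 2" using assms(3) by (rule order_trans)
  have "\<exists>x. x \<noteq> v \<and> x \<in> verts G \<and> ends G e = {v, x}" if "e \<in> F" for e
    using incident_edge_ends[OF assms(2) girth2] F that by (metis subsetD)
  then obtain g where g: "\<And>e. e \<in> F \<Longrightarrow> g e \<noteq> v \<and> g e \<in> verts G \<and> ends G e = {v, g e}"
    by metis
  have "inj_on g F"
  proof (rule inj_onI, rule ccontr)
    fix e f assume ef: "e \<in> F" "f \<in> F" "g e = g f" "e \<noteq> f"
    then have "girth G \<le> 2"
      using g[of e] g[of f] F assms(4)
      by (intro girth_le_parallel[of e G f v "g e"]) (auto simp: incident_edges_def)
    \<comment> \<open>Parallel edges force \<open>n\<close> to be at most 2, and then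
      \<open>F\<close> is too small to contain both \<open>e\<close> and \<open>f\<close>.\<close>
    with assms(3) have "enat n \<le> 2" by (rule order_trans)
    then have "card F \<le> Suc 0" using F by (simp add: numeral_eq_enat)
    \<comment> \<open>Infinite sets have cardinality 0, whereas \<open>card F = n - 1\<close> is
      positive.\<close>
    moreover have "finite F" using F assms(1) by (intro card_ge_0_finite) simp
    ultimately show False using ef by (simp add: card_le_Suc0_iff_eq)
  qed
  then have "card (g ` F) = n - 1" using F by (simp add: card_image)
  then have "\<not> g ` F \<subseteq> A" using A card_mono[of A "g ` F"] by linarith
  then obtain e where "e \<in> F" "g e \<notin> A" by blast
  then show thesis using g that by blast
qed

section \<open>Vertices and edges of the splitting\<close>

lemma verts_point_splitting:
  "verts (point_splitting G v T) = Old ` (verts G - {v}) \<union> {New_u, New_w}"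
  by (simp add: point_splitting_def)

lemma adjacent_point_splitting_edge:
  assumes "e \<in> edges G" "ends G e = {x, y}"
  shows "adjacent (point_splitting G v T) (split_end v (e \<in> T) x) (split_end v (e \<in> T) y)"
  unfolding adjacent_def
  using assms by (intro bexI[of _ "Some e"]) (auto simp: point_splitting_def)

lemma adjacent_point_splitting_Old:
  assumes "adjacent G x y" "x \<noteq> v" "y \<noteq> v"
  shows "adjacent (point_splitting G v T) (Old x) (Old y)"
proof -
  from assms(1) obtain e where "e \<in> edges G" "ends G e = {x, y}"
    unfolding adjacent_def by blast
  then show ?thesis
    using adjacent_point_splitting_edge[of e G x y v T] assms(2,3) by (simp add: split_end_def)
qed

lemma card_verts_point_splitting:
  assumes "finite (verts G)" "v \<in> verts G"
  shows "card (verts (point_splitting G v T)) = Suc (card (verts G))"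
proof -
  have "card (Old ` (verts G - {v})) = card (verts G) - 1"
    using assms by (simp add: card_image inj_on_def)
  moreover have "card (verts G) > 0" using assms by (auto simp: card_gt_0_iff)
  moreover have "card (Old ` (verts G - {v}) \<union> {New_u, New_w}) =
      card (Old ` (verts G - {v})) + card {New_u :: 'a split_vertex, New_w}"
    using assms by (intro card_Un_disjoint) auto
  ultimately show ?thesis by (simp add: verts_point_splitting)
qed

section \<open>Deleting vertices from the splitting\<close>

text \<open>Walks from \<open>v\<close> in the smaller graph lift edge by edge. Whenever a walk
  passes through \<open>v\<close>, the lift can switch between the two copies of \<open>v\<close>
  along the new edge. The hypothesis on \<open>Old v\<close> keeps \<open>v\<close> available as a
  starting point.\<close>

lemma connected_delete_verts_point_splitting_keep:
  assumes fin: "finite_graph G" and v: "v \<in> verts G" and new: "New_u \<notin> S" "New_w \<notin> S"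
    and conn: "connected_graph (delete_verts G (Old -` S))" and "Old v \<notin> S"
  shows "connected_graph (delete_verts (point_splitting G v T) S)"
proof -
  let ?H = "delete_verts (point_splitting G v T) S"
  \<comment> \<open>The contraction of the new edge: both new vertices go to
    \<open>v\<close>.\<close>
  define proj where "proj z = (case z of Old x \<Rightarrow> x | _ \<Rightarrow> v)" for z
  have proj_split_end: "proj (split_end v b x) = x" for b x
    by (simp add: proj_def split_end_def)
  have uw: "(adjacent ?H)\<^sup>*\<^sup>* New_u New_w"
    using new by (simp add: r_into_rtranclp adjacent_delete_verts adjacent_point_splitting_new)
  define V where "V z \<longleftrightarrow> z \<in> verts ?H" for z
  \<comment> \<open>Fibres of \<open>proj\<close> are single vertices, except the one over
    \<open>v\<close>, which the new edge connects.\<close>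
  have lifts: "(adjacent ?H)\<^sup>*\<^sup>* a b" if "V a" "V b" "proj a = proj b" for a b
    using that uw adjacent_rtranclp_sym[OF uw]
    by (auto simp: V_def verts_point_splitting proj_def)
  \<comment> \<open>The claim covers the whole fibre over \<open>x\<close>, because the next edge
    may leave from either copy of \<open>v\<close>.\<close>
  have reach: "\<forall>z. V z \<longrightarrow> proj z = x \<longrightarrow> (adjacent ?H)\<^sup>*\<^sup>* New_u z"
    if "(adjacent (delete_verts G (Old -` S)))\<^sup>*\<^sup>* v x" "x \<in> verts G" for x
    using that
  proof (induction rule: rtranclp_induct)
    case base
    then show ?case using lifts[of New_u] new
      by (simp add: V_def proj_def verts_point_splitting)
  next
    case (step x y)
    from step.hyps(2) obtain e where e: "e \<in> edges G" "ends G e = {x, y}" and S: "Old x \<notin> S" "Old y \<notin> S"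
      unfolding adjacent_delete_verts adjacent_def[of G] by auto
    have "x \<in> verts G" using e fin by (auto simp: finite_graph_def)
    \<comment> \<open>The ends of the copy of \<open>e\<close>; membership in \<open>T\<close>
      decides which copy of \<open>v\<close> occurs.\<close>
    let ?x = "split_end v (e \<in> T) x" and ?y = "split_end v (e \<in> T) y"
    have V: "V ?x" "V ?y"
      using S new \<open>x \<in> verts G\<close> step.prems
      by (auto simp: V_def verts_point_splitting split_end_def)
    have "(adjacent ?H)\<^sup>*\<^sup>* New_u ?x" using step.IH \<open>x \<in> verts G\<close> V proj_split_end by blast
    moreover have "adjacent ?H ?x ?y"
      using adjacent_point_splitting_edge[OF e] V by (simp add: adjacent_delete_verts V_def)
    ultimately have y: "(adjacent ?H)\<^sup>*\<^sup>* New_u ?y" by (rule rtranclp.rtrancl_into_rtrancl)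
    show ?case
    proof (intro allI impI)
      fix z assume "V z" "proj z = y"
      then have "(adjacent ?H)\<^sup>*\<^sup>* ?y z" by (intro lifts V) (simp_all add: proj_split_end)
      with y show "(adjacent ?H)\<^sup>*\<^sup>* New_u z" by (rule rtranclp_trans)
    qed
  qed
  have proj_verts: "proj z \<in> verts G" "Old (proj z) \<notin> S" if "V z" for z
    using that v \<open>Old v \<notin> S\<close> by (auto simp: V_def proj_def verts_point_splitting)
  have "(adjacent ?H)\<^sup>*\<^sup>* New_u z" if "V z" for z
  proof -
    have "(adjacent (delete_verts G (Old -` S)))\<^sup>*\<^sup>* v (proj z)"
      using conn v \<open>Old v \<notin> S\<close> proj_verts[OF that]
      by (simp add: connected_graph_def)
    then show ?thesis using reach proj_verts that by blast
  qed
  moreover have "New_u \<in> verts ?H" using new by (simp add: verts_point_splitting)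
  ultimately show ?thesis unfolding V_def by (rule connected_graphI[rotated])
qed

text \<open>With \<open>v\<close> deleted as well, walks of \<open>G\<close> use only old vertices
  and carry over unchanged. Each surviving new vertex is then attached by one edge to a surviving
  old vertex.\<close>

lemma connected_delete_verts_point_splitting_remove:
  assumes conn: "connected_graph (delete_verts G (insert v (Old -` S)))"
    and new: "\<And>z. z \<in> {New_u, New_w} \<Longrightarrow> z \<notin> S \<Longrightarrow>
      \<exists>x\<in>verts G - {v}. Old x \<notin> S \<and> adjacent (point_splitting G v T) z (Old x)"
  shows "connected_graph (delete_verts (point_splitting G v T) S)"
proof -
  let ?G = "delete_verts G (insert v (Old -` S))"
  let ?H = "delete_verts (point_splitting G v T) S"
  obtain r where r: "r \<in> verts ?G"
    using conn by (auto simp: connected_graph_def)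
  have old: "(adjacent ?H)\<^sup>*\<^sup>* (Old r) (Old x)" if "x \<in> verts ?G" for x
  proof -
    have "(adjacent ?G)\<^sup>*\<^sup>* r x" using conn r that by (simp add: connected_graph_def)
    then show ?thesis
    proof (induction rule: rtranclp_induct)
      case (step x y)
      from step.hyps(2) have "adjacent ?H (Old x) (Old y)"
        by (simp add: adjacent_delete_verts adjacent_point_splitting_Old)
      with step.IH show ?case by (rule rtranclp.rtrancl_into_rtrancl)
    qed simp
  qed
  show ?thesis
  proof (rule connected_graphI)
    show "Old r \<in> verts ?H" using r by (simp add: verts_point_splitting)
    fix z assume z: "z \<in> verts ?H"
    show "(adjacent ?H)\<^sup>*\<^sup>* (Old r) z"
    proof (cases "z \<in> {New_u, New_w}")
      case True
      then obtain x where x: "x \<in> verts ?G" "adjacent ?H z (Old x)"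
        using new[of z] z by (auto simp: adjacent_delete_verts)
      show ?thesis
        by (rule rtranclp.rtrancl_into_rtrancl[OF old[OF x(1)] adjacent_sym[OF x(2)]])
    next
      case False
      then show ?thesis using old z by (auto simp: verts_point_splitting)
    qed
  qed
qed

section \<open>Degree count at the split vertex and the choice of deleted sets\<close>

theorem theorem4p2:
  fixes n :: nat
    and G :: "('v, 'e) multigraph"
    and v :: 'v
    and T :: "'e set"
  assumes "n \<ge> 2"
    and "finite_graph G"
    and "n_connected n G"
    and "girth G \<ge> enat n"
    and "v \<in> verts G"
    and "degree G v \<ge> 2 * n - 2"
    and "T \<subseteq> incident_edges G v"
    and "card T = n - 1"
  shows "n_connected n (point_splitting G v T)"
proof -
  have fin: "finite (verts G)" "finite (incident_edges G v)"
    using assms(2) by (simp_all add: finite_graph_def incident_edges_def)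
  have "(2 :: enat) \<le> enat n" using assms(1) by (simp add: numeral_eq_enat)
  then have girth2: "girth G \<ge> 2" using assms(4) by (rule order_trans)
  \<comment> \<open>Without loops at \<open>v\<close>, the degree is just the number of incident
    edges.\<close>
  have "ends G e \<noteq> {v}" if "e \<in> edges G" for e
  proof
    assume "ends G e = {v}"
    then have "e \<in> incident_edges G v" using that by (simp add: incident_edges_def)
    then obtain x where "x \<noteq> v" "ends G e = {v, x}"
      using incident_edge_ends[OF assms(2) girth2] by metis
    with \<open>ends G e = {v}\<close> show False by auto
  qed
  then have "{e \<in> edges G. ends G e = {v}} = {}" by blast
  then have "card (incident_edges G v) \<ge> 2 * n - 2"
    using assms(6) by (simp only: degree_def card.empty)
  \<comment> \<open>Of at least \<open>2 * n - 2\<close> edges at \<open>v\<close>, removing the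
    \<open>n - 1\<close> in \<open>T\<close> leaves enough for a set \<open>F\<close> that does for
    \<open>New_w\<close> what \<open>T\<close> does for \<open>New_u\<close>.\<close>
  then have "card (incident_edges G v - T) \<ge> n - 1"
    using assms(7,8) card_Diff_subset[OF finite_subset[OF assms(7) fin(2)] assms(7)] by simp
  then obtain F where F: "F \<subseteq> incident_edges G v - T" "card F = n - 1"
    by (meson obtain_subset_with_card_n)
  show ?thesis
    unfolding n_connected_def
  proof (intro conjI allI impI)
    show "n < card (verts (point_splitting G v T))"
      using assms(3,5) fin(1) by (simp add: card_verts_point_splitting n_connected_def)
  next
    fix S assume S: "S \<subseteq> verts (point_splitting G v T)" "card S < n"
    let ?A = "Old -` S"
    have finS: "finite S"
      using S(1) by (rule finite_subset) (simp add: verts_point_splitting fin)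
    have finA: "finite ?A" using finS by (simp add: finite_vimageI inj_def)
    have A: "?A \<subseteq> verts G - {v}" using S by (auto simp: verts_point_splitting)
    have cardA: "card ?A = card (Old ` ?A)" by (rule card_image[symmetric]) (simp add: inj_on_def)
    have conn: "connected_graph (delete_verts G B)" if "B \<subseteq> verts G" "card B < n" for B
      using assms(3) that by (simp add: n_connected_def)
    show "connected_graph (delete_verts (point_splitting G v T) S)"
    proof (cases "New_u \<notin> S \<and> New_w \<notin> S")
      case True
      have "card ?A \<le> card S" unfolding cardA using finS by (intro card_mono) auto
      with True show ?thesis
        using A S(2) assms(2,5)
        by (intro connected_delete_verts_point_splitting_keep conn) auto
    next
      case False
      \<comment> \<open>A new vertex in \<open>S\<close> is missing from the image of
        \<open>?A\<close>. This strictness leaves room for adding \<open>v\<close> to the deleted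
        set while staying below \<open>n\<close>.\<close>
      then have "card (Old ` ?A) < card S" using finS by (intro psubset_card_mono) auto
      then have less: "card ?A < n - 1" using S cardA by simp
      have "connected_graph (delete_verts G (insert v ?A))"
        using A assms(5) less finA by (intro conn) (auto simp: card_insert_if)
      then show ?thesis
      proof (rule connected_delete_verts_point_splitting_remove)
        fix z :: "'v split_vertex" assume "z \<in> {New_u, New_w}"
        then consider "z = New_u" | "z = New_w" by blast
        then show "\<exists>x\<in>verts G - {v}. Old x \<notin> S \<and> adjacent (point_splitting G v T) z (Old x)"
        proof cases
          case 1
          obtain e x where "e \<in> T" "x \<noteq> v" "x \<in> verts G" "x \<notin> ?A" "ends G e = {v, x}"
            using incident_edge_avoiding[OF assms(1,2,4,5,7,8) finA less] .
          moreover from this have "e \<in> edges G \<inter> T"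
            using assms(7) by (auto simp: incident_edges_def)
          ultimately show ?thesis
            unfolding 1 adjacent_point_splitting_new by blast
        next
          case 2
          have Fv: "F \<subseteq> incident_edges G v" using F by blast
          obtain e x where "e \<in> F" "x \<noteq> v" "x \<in> verts G" "x \<notin> ?A" "ends G e = {v, x}"
            using incident_edge_avoiding[OF assms(1,2,4,5) Fv F(2) finA less] .
          moreover from this have "e \<in> edges G - T"
            using F(1) by (auto simp: incident_edges_def)
          ultimately show ?thesis
            unfolding 2 adjacent_point_splitting_new by blast
        qed
      qed
    qed
  qed
qed

end
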